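(* If $G$ is a connected graph that is a proper interval $k$-graph or a unit interval $k$-graph, then $G$ has a dominating pair of vertices.
   Context: All graphs are finite and simple. A graph $G$ is an interval $k$-graph if there is a one-to-one correspondence $v\mapsto I_v$ between $V(G)$ and a family of closed intervals of the real line, together with a partition of the family into at most $k$ classes, such that distinct vertices $u,v$ are adjacent if and only if $I_u\cap I_v\neq\emptyset$ and $I_u,I_v$ lie in different classes. $G$ is a proper interval $k$-graph if it has such a representation in which no interval properly contains another, and a unit interval $k$-graph if it has such a representation in which all intervals have the same length. A dominating pair is a pair of vertices $u,v$ such that there is a $u,v$-path $P$ in $G$ with every vertex of $G$ either on $P$ or adjacent to a vertex of $P$. *)

theory Defs
  imports
    Complex_Main
    "HOL-Library.Disjoint_Sets"
    "Graph_Theory.Graph_Theory"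
begin

(* Finite simple graphs are the instances of the locale graph of Graph_Theory (finite, loop-free
   symmetric digraphs without parallel arcs).  Adjacency of u and v is u \<rightarrow>\<^bsub>G\<^esub> v. *)

(* The family of intervals is the set I ` verts G; injectivity of I makes v \<mapsto> I v a one-to-one
   correspondence.  One-point intervals are allowed.  The classes in a partition_on are nonempty, so
   "at most k classes" is card \<P> \<le> k (\<P> is finite because verts G is). *)
definition interval_k_representation ::
    "('a, 'b) pre_digraph \<Rightarrow> nat \<Rightarrow> ('a \<Rightarrow> real set) \<Rightarrow> real set set set \<Rightarrow> bool" where
  "interval_k_representation G k I \<P> \<longleftrightarrow>
     inj_on I (verts G) \<and>
     (\<forall>v \<in> verts G. \<exists>a b. a \<le> b \<and> I v = {a..b}) \<and>
     partition_on (I ` verts G) \<P> \<and>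
     card \<P> \<le> k \<and>
     (\<forall>u \<in> verts G. \<forall>v \<in> verts G. u \<noteq> v \<longrightarrow>
        (u \<rightarrow>\<^bsub>G\<^esub> v \<longleftrightarrow>
           I u \<inter> I v \<noteq> {} \<and>
           (\<exists>A \<in> \<P>. \<exists>B \<in> \<P>. A \<noteq> B \<and> I u \<in> A \<and> I v \<in> B)))"

definition proper_interval_k_graph :: "nat \<Rightarrow> ('a, 'b) pre_digraph \<Rightarrow> bool" where
  "proper_interval_k_graph k G \<longleftrightarrow>
     (\<exists>I \<P>. interval_k_representation G k I \<P> \<and>
        (\<forall>u \<in> verts G. \<forall>v \<in> verts G. \<not> I u \<subset> I v))"

definition unit_interval_k_graph :: "nat \<Rightarrow> ('a, 'b) pre_digraph \<Rightarrow> bool" where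
  "unit_interval_k_graph k G \<longleftrightarrow>
     (\<exists>I \<P>. interval_k_representation G k I \<P> \<and>
        (\<exists>l \<ge> 0. \<forall>v \<in> verts G. \<exists>a. I v = {a..a + l}))"

(* u = v is not excluded: otherwise the one-vertex graph would have no dominating pair.  In a
   connected graph with at least two vertices this makes no difference to the existence of a
   dominating pair, since the path consisting of u alone can be extended to a neighbour of u. *)
definition dominating_pair :: "('a, 'b) pre_digraph \<Rightarrow> 'a \<Rightarrow> 'a \<Rightarrow> bool" where
  "dominating_pair G u v \<longleftrightarrow>
     (\<exists>p. vpath p G \<and> hd p = u \<and> last p = v \<and>
        (\<forall>w \<in> verts G. w \<in> set p \<or> (\<exists>x \<in> set p. w \<rightarrow>\<^bsub>G\<^esub> x)))"

end

theory Submission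
  imports Defs
begin

text \<open>
  If no interval contains another one, left and right endpoints induce the same order on the
  vertices.  A path from the first to the last vertex jumps over each vertex \<open>w\<close> it misses along
  some edge \<open>x\<close>, \<open>y\<close>; the interval of \<open>w\<close> then meets those of \<open>x\<close> and \<open>y\<close>.  Since \<open>x\<close> and \<open>y\<close> are
  in different classes, \<open>w\<close> is in a different class from one of them.
\<close>

text \<open>A discrete intermediate value argument: \<open>f\<close> avoids the value
  \<open>c\<close> on the walk, so the first arc that leaves the region below \<open>c\<close> must
  land strictly above it.\<close>

lemma vwalk_arc_crossing:
  fixes f :: "'a \<Rightarrow> 'c::linorder"
  assumes "vwalk p G" and "f (hd p) < c" and "c < f (last p)" and "c \<notin> f ` set p"
  shows "\<exists>x \<in> set p. \<exists>y \<in> set p. x \<rightarrow>\<^bsub>G\<^esub> y \<and> f x < c \<and> c < f y"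
  using assms
proof (induction p rule: vwalk_induct)
  case (Base u)
  then show ?case by simp
next
  case (Cons u v es)
  show ?case
  proof (cases "f v < c")
    case True
    with Cons show ?thesis by auto
  next
    case False
    with Cons.prems have "c < f v" by (auto simp: not_less_iff_gr_or_eq)
    with Cons show ?thesis by auto
  qed
qed

text \<open>A class containing \<open>I w\<close> differs from at least one of the two distinct
  classes that witness the arc from \<open>x\<close> to \<open>y\<close>. As \<open>I w\<close>
  meets both intervals, that difference yields an adjacency.\<close>

lemma interval_k_representation_dominates:
  assumes rep: "interval_k_representation G k I \<P>"
    and xyw: "x \<in> verts G" "y \<in> verts G" "w \<in> verts G" "w \<noteq> x" "w \<noteq> y" "x \<noteq> y"
    and "x \<rightarrow>\<^bsub>G\<^esub> y"
    and wx: "I w \<inter> I x \<noteq> {}" and wy: "I w \<inter> I y \<noteq> {}"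
  shows "w \<rightarrow>\<^bsub>G\<^esub> x \<or> w \<rightarrow>\<^bsub>G\<^esub> y"
proof -
  have adj: "u \<rightarrow>\<^bsub>G\<^esub> v \<longleftrightarrow> I u \<inter> I v \<noteq> {} \<and>
      (\<exists>A \<in> \<P>. \<exists>B \<in> \<P>. A \<noteq> B \<and> I u \<in> A \<and> I v \<in> B)"
    if "u \<in> verts G" "v \<in> verts G" "u \<noteq> v" for u v
    using rep that unfolding interval_k_representation_def by blast
  have "\<Union>\<P> = I ` verts G"
    using rep by (auto simp: interval_k_representation_def partition_on_def)
  then obtain C where "C \<in> \<P>" "I w \<in> C" using xyw by blast
  moreover obtain A B where "A \<in> \<P>" "B \<in> \<P>" "A \<noteq> B" "I x \<in> A" "I y \<in> B"
    using adj[of x y] xyw \<open>x \<rightarrow>\<^bsub>G\<^esub> y\<close> by blast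
  ultimately show ?thesis
    using adj[of w x] adj[of w y] xyw wx wy by metis
qed

text \<open>Any path with these ends will do: \<open>first\<close> and \<open>last\<close> force it
  to cross the left endpoint of every vertex that it misses.\<close>

lemma vpath_between_extremes_dominating:
  fixes a b :: "'a \<Rightarrow> real"
  assumes rep: "interval_k_representation G k I \<P>"
    and proper: "\<forall>u \<in> verts G. \<forall>v \<in> verts G. \<not> I u \<subset> I v"
    and I: "\<And>v. v \<in> verts G \<Longrightarrow> a v \<le> b v \<and> I v = {a v..b v}"
    and p: "vpath p G"
    and first: "\<And>v. v \<in> verts G \<Longrightarrow> a (hd p) \<le> a v"
    and last: "\<And>v. v \<in> verts G \<Longrightarrow> a v \<le> a (last p)"
  shows "dominating_pair G (hd p) (last p)"
proof -
  have inj: "inj_on I (verts G)"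
    using rep by (simp add: interval_k_representation_def)
  have mono: "b u < b v" if "u \<in> verts G" "v \<in> verts G" "a u < a v" for u v
  proof (rule ccontr)
    assume "\<not> b u < b v"
    with that I[of u] I[of v] have "I v \<subset> I u" by auto
    with proper that show False by blast
  qed
  \<comment> \<open>Intervals with a common left endpoint are nested. This makes the crossing
    strict: a missed vertex shares its left endpoint with no vertex of the path.\<close>
  have a_inj: "u = v" if "u \<in> verts G" "v \<in> verts G" "a u = a v" for u v
  proof -
    have "I u \<subseteq> I v \<or> I v \<subseteq> I u" using that I[of u] I[of v] by auto
    with proper that have "I u = I v" by blast
    with inj that show ?thesis by (auto dest: inj_onD)
  qed
  have p_verts: "set p \<subseteq> verts G" and "p \<noteq> []" and walk: "vwalk p G"
    using p by (auto simp: vpath_def vwalk_def)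
  have "\<exists>x \<in> set p. w \<rightarrow>\<^bsub>G\<^esub> x" if w: "w \<in> verts G" "w \<notin> set p" for w
  proof -
    have notin: "a w \<notin> a ` set p" using a_inj w p_verts by blast
    moreover have "hd p \<in> set p" "last p \<in> set p" using \<open>p \<noteq> []\<close> by simp_all
    ultimately have "a (hd p) < a w" "a w < a (last p)"
      using first[of w] last[of w] w by (metis image_eqI order_le_less)+
    from vwalk_arc_crossing[OF walk this notin]
    obtain x y where xy: "x \<in> set p" "y \<in> set p" "x \<rightarrow>\<^bsub>G\<^esub> y" "a x < a w" "a w < a y"
      by blast
    have in_verts: "x \<in> verts G" "y \<in> verts G" using xy p_verts by auto
    have ne: "w \<noteq> x" "w \<noteq> y" "x \<noteq> y" using xy by auto
    have "I x \<inter> I y \<noteq> {}"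
      using rep in_verts ne xy unfolding interval_k_representation_def by blast
    then have "a y \<le> b x" using I in_verts by auto
    moreover have "b x < b w" using mono in_verts w xy by blast
    \<comment> \<open>The common points come from the chain
      \<open>a x < a w < a y \<le> b x < b w\<close>.\<close>
    ultimately have "a y \<in> I w \<inter> I y" "a w \<in> I w \<inter> I x"
      using I[of x] I[of y] I[of w] in_verts w xy by auto
    then have "w \<rightarrow>\<^bsub>G\<^esub> x \<or> w \<rightarrow>\<^bsub>G\<^esub> y"
      using interval_k_representation_dominates[OF rep in_verts w(1) ne \<open>x \<rightarrow>\<^bsub>G\<^esub> y\<close>] by blast
    with xy show ?thesis by blast
  qed
  with p show ?thesis unfolding dominating_pair_def by blast
qed

text \<open>The same representation serves, since nested intervals of equal length coincide.\<close>

lemma unit_imp_proper_interval_k_graph: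
  assumes "unit_interval_k_graph k G"
  shows "proper_interval_k_graph k G"
proof -
  obtain I \<P> l where rep: "interval_k_representation G k I \<P>"
    and l: "0 \<le> l" "\<forall>v \<in> verts G. \<exists>a. I v = {a..a + l}"
    using assms unfolding unit_interval_k_graph_def by blast
  have "\<not> I u \<subset> I v" if uv: "u \<in> verts G" "v \<in> verts G" for u v
  proof -
    obtain a c where "I u = {a..a + l}" "I v = {c..c + l}" using l uv by meson
    with l show ?thesis by auto
  qed
  with rep show ?thesis unfolding proper_interval_k_graph_def by blast
qed

theorem theorem3p2:
  fixes G :: "('a, 'b) pre_digraph" and k :: nat
  assumes "graph G"
    and "Digraph_Component.connected G"
    and "proper_interval_k_graph k G \<or> unit_interval_k_graph k G"
  shows "\<exists>u \<in> verts G. \<exists>v \<in> verts G. dominating_pair G u v"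
proof -
  interpret graph G by fact
  obtain I \<P> where rep: "interval_k_representation G k I \<P>"
    and proper: "\<forall>u \<in> verts G. \<forall>v \<in> verts G. \<not> I u \<subset> I v"
    using assms(3) unit_imp_proper_interval_k_graph
    unfolding proper_interval_k_graph_def by blast
  from rep obtain a b :: "'a \<Rightarrow> real"
    where I: "\<And>v. v \<in> verts G \<Longrightarrow> a v \<le> b v \<and> I v = {a v..b v}"
    unfolding interval_k_representation_def by metis
  \<comment> \<open>Connectedness refers to the symmetric closure of \<open>G\<close>; symmetry of
    the arcs turns it into directed reachability, which supplies the path.\<close>
  have sc: "strongly_connected G"
    using sym_arcs assms(2) by (rule symmetric_connected_imp_strongly_connected)
  then have ne: "verts G \<noteq> {}" by (simp add: strongly_connected_def)
  \<comment> \<open>The ends of the path are the vertices with extreme left endpoints; if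
    \<open>G\<close> has a single vertex, they coincide.\<close>
  obtain u where u: "u \<in> verts G" "a u = Min (a ` verts G)"
    using Min_in[of "a ` verts G"] finite_verts ne by fastforce
  obtain v where v: "v \<in> verts G" "a v = Max (a ` verts G)"
    using Max_in[of "a ` verts G"] finite_verts ne by fastforce
  have "u \<rightarrow>\<^sup>*\<^bsub>G\<^esub> v" using sc u v by (simp add: strongly_connected_def)
  then obtain p where p: "vpath p G" "hd p = u" "last p = v"
    by (auto simp: reachable_vpath_conv)
  have "dominating_pair G (hd p) (last p)"
    using finite_verts u v p
    by (intro vpath_between_extremes_dominating[OF rep proper I p(1)]) simp_all
  with u v p show ?thesis by blast
qed

end
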